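(* Let $l\ge 1$ and $j\ge 1$ be integers, let $A$ be an $n\times n$ matrix, and let vectors $\bar v_0,\dots,\bar v_j$ and $\bar z_0,\dots,\bar z_j$, scalars $\bar\gamma_k,\bar\delta_k,\sigma_k,\bar g_{k,m}$, local rounding errors $\xi^{\bar v}_m,\xi^{\bar z}_m$, and the matrices $\bar V_m,\bar Z_m,\bar G_m,\bar H_{j+1,j},\bar B_{j+1,j},\bar\Delta_{j+1,j},\Theta^{\bar v}_m,\Theta^{\bar z}_m$ be as described in the context; in particular $\bar G_{j+1}\bar B_{j+1,j}=\bar H_{j+1,j}\bar G_j$. Let $\mathcal F_{j+1}=\bar{\boldsymbol V}_{j+1}-\bar V_{j+1}$ be the matrix of gaps between the true basis vectors $\bar{\mathbf v}_k$ and the computed basis vectors $\bar v_k$, $0\le k\le j$. Then $$\mathcal F_{j+1}=\left(\Theta^{\bar z}_j-A\,\Theta^{\bar v}_j+\Theta^{\bar v}_{j+1}\,\bar B_{j+1,j}\right)\bar G_j^{-1}\,\bar\Delta_{j+1,j}^{+},$$ where $\bar\Delta_{j+1,j}^{+}=(\bar\Delta_{j+1,j}^*\bar\Delta_{j+1,j})^{-1}\bar\Delta_{j+1,j}^*$.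
   Context: This models the finite precision deep pipelined Conjugate Gradient method p($l$)-CG with pipeline length $l$. All vectors have length $n$; indices of vectors and of rows and columns start at $0$; any vector or scalar with a negative index is taken to be zero. The scalars $\bar\delta_0,\dots,\bar\delta_{j-1}$ and $\bar g_{0,0},\dots,\bar g_{j,j}$ are nonzero. Computed vectors. $\bar z_0=\bar v_0$, $\bar g_{0,0}=1$, $\xi^{\bar v}_0=0$, and for $0\le k<j$: $$\bar v_{k+1}=\Big(\bar z_{k+1}-\sum_{m=k-2l+1}^{k}\bar g_{m,k+1}\bar v_m\Big)/\bar g_{k+1,k+1}+\xi^{\bar v}_{k+1},$$ $$\bar z_{k+1}=(A-\sigma_kI)\bar z_k+\xi^{\bar z}_{k+1}\ \text{ if } k<l,\qquad \bar z_{k+1}=(A\bar z_k-\bar\gamma_{k-l}\bar z_k-\bar\delta_{k-l-1}\bar z_{k-1})/\bar\delta_{k-l}+\xi^{\bar z}_{k+1}\ \text{ if } k\ge l.$$ These equations hold exactly; the $\xi$'s are the local rounding errors. True basis vectors. $\bar{\mathbf v}_0=\bar v_0$ and $\bar{\mathbf v}_{k+1}=(A\bar v_k-\bar\gamma_k\bar v_k-\bar\delta_{k-1}\bar v_{k-1})/\bar\delta_k$ for $0\le k<j$. Matrices. $\bar V_m=[\bar v_0,\dots,\bar v_{m-1}]$, $\bar Z_m=[\bar z_0,\dots,\bar z_{m-1}]$, $\bar{\boldsymbol V}_m=[\bar{\mathbf v}_0,\dots,\bar{\mathbf v}_{m-1}]$. $\bar G_m$ is the $m\times m$ upper triangular matrix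 with entries $\bar g_{k,p}$ for $\max(0,p-2l)\le k\le p$ and zeros elsewhere. $\bar H_{j+1,j}$ is the $(j+1)\times j$ tridiagonal matrix whose column $k$ has entries $\bar\delta_{k-1}$ in row $k-1$ (if $k\ge1$), $\bar\gamma_k$ in row $k$, $\bar\delta_k$ in row $k+1$. $\bar B_{j+1,j}$ is the $(j+1)\times j$ matrix whose column $k$ has, for $k<l$, entries $\sigma_k$ in row $k$ and $1$ in row $k+1$, and, for $k\ge l$, entries $\bar\delta_{k-l-1}$ in row $k-1$ (absent when $k=l$), $\bar\gamma_{k-l}$ in row $k$, and $\bar\delta_{k-l}$ in row $k+1$; all other entries are zero. $\bar\Delta_{j+1,j}$ is the $(j+1)\times j$ matrix with entry $\bar\delta_k$ in position $(k+1,k)$ for $0\le k\le j-1$ and zeros elsewhere. It is assumed (it follows from the way the scalars are computed in the algorithm) that $\bar G_{j+1}\bar B_{j+1,j}=\bar H_{j+1,j}\bar G_j$. Rounding error matrices. $\Theta^{\bar v}_m=-[\bar g_{0,0}\xi^{\bar v}_0,\bar g_{1,1}\xi^{\bar v}_1,\dots,\bar g_{m-1,m-1}\xi^{\bar v}_{m-1}]$, and $\Theta^{\bar z}_m=[\theta^{\bar z}_0,\dots,\theta^{\bar z}_{m-1}]$ with $\theta^{\bar z}_k=-\xi^{\bar z}_{k+1}$ for $k<l$ and $\theta^{\bar z}_k=-\bar\delta_{k-l}\xi^{\bar z}_{k+1}$ for $k\ge l$. *)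

theory Defs
  imports
    "Jordan_Normal_Form.Schur_Decomposition"
    "Jordan_Normal_Form.Gauss_Jordan_Elimination"
begin

(* previous d f k is the term of f with index k - 1, where the term with index -1 is d. *)
definition previous :: "'b \<Rightarrow> (nat \<Rightarrow> 'b) \<Rightarrow> nat \<Rightarrow> 'b" where
  "previous d f k = (case k of 0 \<Rightarrow> d | Suc i \<Rightarrow> f i)"

definition col_mat :: "nat \<Rightarrow> nat \<Rightarrow> (nat \<Rightarrow> 'a vec) \<Rightarrow> 'a mat" where
  "col_mat n m f = mat_of_cols n (map f [0..<m])"

(* The recurrence is driven by the computed vectors v, not by the true basis vectors. *)
definition true_basis ::
  "nat \<Rightarrow> 'a::field mat \<Rightarrow> (nat \<Rightarrow> 'a vec) \<Rightarrow> (nat \<Rightarrow> 'a) \<Rightarrow> (nat \<Rightarrow> 'a) \<Rightarrow> nat \<Rightarrow> 'a vec" where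
  "true_basis n A v \<gamma> \<delta> i = (case i of
      0 \<Rightarrow> v 0
    | Suc k \<Rightarrow> (1 / \<delta> k) \<cdot>\<^sub>v
        (A *\<^sub>v v k - \<gamma> k \<cdot>\<^sub>v v k - previous 0 \<delta> k \<cdot>\<^sub>v previous (0\<^sub>v n) v k))"

(* p \<le> k + 2 * l expresses p - 2 l \<le> k without truncated subtraction. *)
definition G_mat :: "nat \<Rightarrow> (nat \<Rightarrow> nat \<Rightarrow> 'a::zero) \<Rightarrow> nat \<Rightarrow> 'a mat" where
  "G_mat l g m = mat m m (\<lambda>(k, p). if p \<le> k + 2 * l \<and> k \<le> p then g k p else 0)"

definition H_mat :: "(nat \<Rightarrow> 'a::zero) \<Rightarrow> (nat \<Rightarrow> 'a) \<Rightarrow> nat \<Rightarrow> 'a mat" where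
  "H_mat \<gamma> \<delta> j = mat (j + 1) j (\<lambda>(i, k).
     if i + 1 = k then previous 0 \<delta> k
     else if i = k then \<gamma> k
     else if i = k + 1 then \<delta> k
     else 0)"

definition B_mat ::
  "nat \<Rightarrow> (nat \<Rightarrow> 'a::zero_neq_one) \<Rightarrow> (nat \<Rightarrow> 'a) \<Rightarrow> (nat \<Rightarrow> 'a) \<Rightarrow> nat \<Rightarrow> 'a mat" where
  "B_mat l \<sigma> \<gamma> \<delta> j = mat (j + 1) j (\<lambda>(i, k).
     if k < l then
       (if i = k then \<sigma> k
        else if i = k + 1 then 1
        else 0)
     else
       (if i + 1 = k then previous 0 \<delta> (k - l)
        else if i = k then \<gamma> (k - l)
        else if i = k + 1 then \<delta> (k - l)
        else 0))"

definition Delta_mat :: "(nat \<Rightarrow> 'a::zero) \<Rightarrow> nat \<Rightarrow> 'a mat" where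
  "Delta_mat \<delta> j = mat (j + 1) j (\<lambda>(i, k). if i = k + 1 then \<delta> k else 0)"

definition Theta_v ::
  "nat \<Rightarrow> (nat \<Rightarrow> nat \<Rightarrow> 'a::ring) \<Rightarrow> (nat \<Rightarrow> 'a vec) \<Rightarrow> nat \<Rightarrow> 'a mat" where
  "Theta_v n g \<xi>v m = - col_mat n m (\<lambda>k. g k k \<cdot>\<^sub>v \<xi>v k)"

definition Theta_z ::
  "nat \<Rightarrow> nat \<Rightarrow> (nat \<Rightarrow> 'a::ring) \<Rightarrow> (nat \<Rightarrow> 'a vec) \<Rightarrow> nat \<Rightarrow> 'a mat" where
  "Theta_z n l \<delta> \<xi>z m = col_mat n m (\<lambda>k.
     if k < l then - \<xi>z (k + 1) else - (\<delta> (k - l) \<cdot>\<^sub>v \<xi>z (k + 1)))"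

(* Unspecified when A is singular. *)
definition inverse_mat :: "'a::field mat \<Rightarrow> 'a mat" where
  "inverse_mat A = the (mat_inverse A)"

(* mat_adjoint is the conjugate transpose, hence the plain transpose over the reals. *)
definition left_pinv :: "'a::conjugatable_field mat \<Rightarrow> 'a mat" where
  "left_pinv D = inverse_mat (mat_adjoint D * D) * mat_adjoint D"

end

(* Write V, Z for the matrices of computed vectors and W for that of the true basis vectors, so that
   F = W - V. In matrix form the recurrences read
     Z_m = V_m G_m + Theta_v_m,   Z_{j+1} B = A Z_j - Theta_z_j,   F Delta = A V_j - V_{j+1} H.
   With G_{j+1} B = H G_j, the last one gives F Delta G_j = A V_j G_j - V_{j+1} G_{j+1} B. Eliminating V
   by the first relation and then Z by the second leaves only rounding error terms. The factor Delta
   can be cancelled by its left pseudoinverse, though this is not a right inverse, because the first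
   column of F vanishes. *)
theory Submission
  imports Defs
begin

section \<open>Matrices given by columns, triangular inverses and adjoints\<close>

lemma col_mat_carrier [simp]: "col_mat n m f \<in> carrier_mat n m"
  by (intro carrier_matI) (simp_all add: col_mat_def)

lemma dim_col_mat_columns [simp]:
  "dim_row (col_mat n m f) = n" "dim_col (col_mat n m f) = m"
  by (simp_all add: col_mat_def)

lemma col_mat_index [simp]:
  "i < n \<Longrightarrow> k < m \<Longrightarrow> col_mat n m f $$ (i, k) = f k $ i"
  by (simp add: col_mat_def mat_of_cols_index)

lemma mult_mat_index:
  assumes "A \<in> carrier_mat m p" "B \<in> carrier_mat p r" "i < m" "k < r"
  shows "(A * B) $$ (i, k) = (\<Sum>q<p. A $$ (i, q) * B $$ (q, k))"
  using assms by (auto simp: scalar_prod_def lessThan_atLeast0)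

lemma smult_one_mult_vec:
  fixes w :: "'a::comm_ring_1 vec"
  assumes "w \<in> carrier_vec n"
  shows "(c \<cdot>\<^sub>m 1\<^sub>m n) *\<^sub>v w = c \<cdot>\<^sub>v w"
  using assms by (intro eq_vecI) auto

lemma mult_col_mat:
  assumes "A \<in> carrier_mat n n" "\<And>k. k < m \<Longrightarrow> f k \<in> carrier_vec n"
  shows "A * col_mat n m f = col_mat n m (\<lambda>k. A *\<^sub>v f k)"
proof (rule eq_matI)
  fix i k assume "i < dim_row (col_mat n m (\<lambda>k. A *\<^sub>v f k))" "k < dim_col (col_mat n m (\<lambda>k. A *\<^sub>v f k))"
  then have ik: "i < n" "k < m" by simp_all
  have "col (col_mat n m f) k = f k"
    using ik assms(2)[OF ik(2)] by (auto intro!: eq_vecI)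
  with ik assms(1) show "(A * col_mat n m f) $$ (i, k) = col_mat n m (\<lambda>k. A *\<^sub>v f k) $$ (i, k)"
    by simp
qed (use assms(1) in simp_all)

text \<open>The determinant is the product of the diagonal entries, hence nonzero, so
  \<open>mat_inverse\<close> returns \<open>Some\<close> and the unspecified case of
  \<open>inverse_mat\<close> does not arise. This serves both inverses in the final formula: that of
  \<open>G_mat\<close> and that of the Gram matrix inside \<open>left_pinv\<close>.\<close>

lemma inverse_mat_upper_triangular:
  fixes A :: "'a::field mat"
  assumes A: "A \<in> carrier_mat m m" and "upper_triangular A"
    and diag: "\<And>i. i < m \<Longrightarrow> A $$ (i, i) \<noteq> 0"
  shows "inverse_mat A \<in> carrier_mat m m" "A * inverse_mat A = 1\<^sub>m m"
    "inverse_mat A * A = 1\<^sub>m m"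
proof -
  have "det A = prod_list (diag_mat A)"
    using assms det_upper_triangular by blast
  also have "\<dots> \<noteq> 0"
    using A diag by (auto simp: prod_list_zero_iff diag_mat_def)
  finally have "A \<in> Units (ring_mat TYPE('a) m ())"
    using det_non_zero_imp_unit[OF A, where b = "()"] by blast
  then obtain B where "mat_inverse A = Some B"
    using mat_inverse(1)[OF A, where b = "()"] by blast
  with mat_inverse(2)[OF A] show "inverse_mat A \<in> carrier_mat m m"
    "A * inverse_mat A = 1\<^sub>m m" "inverse_mat A * A = 1\<^sub>m m"
    by (auto simp: inverse_mat_def)
qed

lemma mat_adjoint_carrier [simp]:
  "A \<in> carrier_mat m p \<Longrightarrow> mat_adjoint A \<in> carrier_mat p m"
  by (auto simp: mat_adjoint_def)

lemma mat_adjoint_index: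
  assumes "A \<in> carrier_mat m p" "i < p" "k < m"
  shows "mat_adjoint A $$ (i, k) = conjugate (A $$ (k, i))"
  using assms by (simp add: mat_adjoint_def mat_of_rows_index)

section \<open>Tridiagonal matrices and cancellation of the subdiagonal factor\<close>

definition tridiag_mat :: "(nat \<Rightarrow> 'a::zero) \<Rightarrow> (nat \<Rightarrow> 'a) \<Rightarrow> (nat \<Rightarrow> 'a) \<Rightarrow> nat \<Rightarrow> 'a mat" where
  "tridiag_mat a b c j = mat (j + 1) j (\<lambda>(i, k).
     if i + 1 = k then a k else if i = k then b k else if i = k + 1 then c k else 0)"

lemma H_mat_tridiag: "H_mat \<gamma> \<delta> j = tridiag_mat (previous 0 \<delta>) \<gamma> \<delta> j"
  by (simp add: H_mat_def tridiag_mat_def)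

lemma Delta_mat_tridiag: "Delta_mat \<delta> j = tridiag_mat (\<lambda>_. 0) (\<lambda>_. 0) \<delta> j"
  unfolding Delta_mat_def tridiag_mat_def by (rule eq_matI) auto

text \<open>The distinction between the two phases of the recurrence moves into the three
  coefficient sequences, so that \<open>B_mat\<close> falls under the same product formula as
  \<open>H_mat\<close> and \<open>Delta_mat\<close>.\<close>

lemma B_mat_tridiag:
  "B_mat l \<sigma> \<gamma> \<delta> j = tridiag_mat (\<lambda>k. if k < l then 0 else previous 0 \<delta> (k - l))
     (\<lambda>k. if k < l then \<sigma> k else \<gamma> (k - l)) (\<lambda>k. if k < l then 1 else \<delta> (k - l)) j"
  unfolding B_mat_def tridiag_mat_def by (rule eq_matI) auto

text \<open>Each column of the tridiagonal factor has at most three nonzero entries, so a column of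
  the product is a three-term combination, which is the shape of the recurrences. For
  \<open>k = 0\<close> the superdiagonal entry lies outside the matrix; correspondingly
  \<open>previous (0\<^sub>v n) f 0\<close> is the zero vector.\<close>

lemma col_mat_mult_tridiag_mat:
  fixes f :: "nat \<Rightarrow> 'a::comm_ring_1 vec"
  assumes "i < n" "k < j"
  shows "(col_mat n (j + 1) f * tridiag_mat a b c j) $$ (i, k) =
    a k * previous (0\<^sub>v n) f k $ i + b k * f k $ i + c k * f (k + 1) $ i"
proof -
  have "(col_mat n (j + 1) f * tridiag_mat a b c j) $$ (i, k) =
    (\<Sum>q<j + 1. f q $ i * (if q + 1 = k then a k else if q = k then b k
      else if q = k + 1 then c k else 0))"
    by (subst mult_mat_index[where m = n and p = "j + 1" and r = j])
      (use assms in \<open>auto simp: tridiag_mat_def intro!: sum.cong\<close>)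
  also have "\<dots> = (\<Sum>q<j + 1. (if q + 1 = k then a k * f q $ i else 0)
      + (if q = k then b k * f q $ i else 0) + (if q = k + 1 then c k * f q $ i else 0))"
    by (intro sum.cong) auto
  also have "\<dots> = (\<Sum>q<j + 1. if q + 1 = k then a k * f q $ i else 0)
      + b k * f k $ i + c k * f (k + 1) $ i"
    using assms by (simp add: sum.distrib sum.delta)
  also have "(\<Sum>q<j + 1. if q + 1 = k then a k * f q $ i else 0)
      = a k * previous (0\<^sub>v n) f k $ i"
    using assms by (cases k) (auto simp: previous_def sum.delta)
  finally show ?thesis .
qed

text \<open>A zero first column lets \<open>F\<close> factor as \<open>M * S\<close>, where
  \<open>S\<close> is the adjoint of \<open>D = Delta_mat \<delta> j\<close>. Then
  \<open>F * D\<close> times the pseudoinverse is \<open>M * (S * D)\<close> times the inverse of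
  \<open>S * D\<close> times \<open>S\<close>, which collapses to \<open>M * S\<close>.\<close>

lemma mult_Delta_mat_left_pinv:
  fixes F :: "'a::conjugatable_field mat"
  assumes F: "F \<in> carrier_mat n (j + 1)" and F0: "\<And>i. i < n \<Longrightarrow> F $$ (i, 0) = 0"
    and \<delta>: "\<And>k. k < j \<Longrightarrow> \<delta> k \<noteq> 0"
  shows "F * Delta_mat \<delta> j * left_pinv (Delta_mat \<delta> j) = F"
proof -
  let ?D = "Delta_mat \<delta> j"
  let ?S = "mat_adjoint ?D"
  let ?N = "?S * ?D"
  have D: "?D \<in> carrier_mat (j + 1) j" by (simp add: Delta_mat_def)
  then have S: "?S \<in> carrier_mat j (j + 1)" by simp
  with D have N: "?N \<in> carrier_mat j j" by (rule mult_carrier_mat[rotated])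
  have S_index: "?S $$ (i, k) = (if k = i + 1 then conjugate (\<delta> i) else 0)"
    if "i < j" "k < j + 1" for i k
    using that by (subst mat_adjoint_index[OF D]) (auto simp: Delta_mat_def)
  have D_index: "?D $$ (i, k) = (if i = k + 1 then \<delta> k else 0)" if "i < j + 1" "k < j" for i k
    using that by (simp add: Delta_mat_def)
  have "?N $$ (i, k) = (if i = k then conjugate (\<delta> i) * \<delta> i else 0)" if "i < j" "k < j" for i k
  proof -
    have "?N $$ (i, k) = (\<Sum>q<j + 1. ?S $$ (i, q) * ?D $$ (q, k))"
      using that by (intro mult_mat_index[OF S D])
    also have "\<dots> = (\<Sum>q<j + 1. if q = i + 1 then if i = k then conjugate (\<delta> i) * \<delta> i else 0 else 0)"
      using that by (intro sum.cong) (auto simp: S_index D_index)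
    finally show ?thesis using that by (simp add: sum.delta)
  qed
  \<comment> \<open>The Gram matrix is diagonal with entries
    \<open>conjugate (\<delta> i) * \<delta> i\<close>, hence upper triangular with nonzero
    diagonal.\<close>
  then have "upper_triangular ?N" "\<And>i. i < j \<Longrightarrow> ?N $$ (i, i) \<noteq> 0"
    using N \<delta> by (auto intro!: upper_triangularI)
  note inv = inverse_mat_upper_triangular[OF N this]
  \<comment> \<open>Right multiplication by \<open>?S\<close> moves column \<open>k\<close> to
    position \<open>k + 1\<close> and scales it by \<open>conjugate (\<delta> k)\<close>;
    \<open>M\<close> is chosen to undo both.\<close>
  define M where "M = mat n j (\<lambda>(i, k). F $$ (i, k + 1) / conjugate (\<delta> k))"
  have M: "M \<in> carrier_mat n j" by (simp add: M_def)
  have FM: "F = M * ?S"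
  proof (rule eq_matI)
    fix i k assume "i < dim_row (M * ?S)" "k < dim_col (M * ?S)"
    with M S have ik: "i < n" "k < j + 1" by auto
    have "(M * ?S) $$ (i, k) = (\<Sum>q<j. M $$ (i, q) * ?S $$ (q, k))"
      using ik by (intro mult_mat_index[OF M S])
    also have "\<dots> = (\<Sum>q<j. if k = q + 1 then F $$ (i, k) else 0)"
      using ik \<delta> by (intro sum.cong) (auto simp: S_index M_def)
    \<comment> \<open>For \<open>k = 0\<close> no \<open>q\<close> satisfies
      \<open>k = q + 1\<close>, so the sum is zero and agrees with \<open>F\<close> by
      \<open>F0\<close>; otherwise only \<open>q = k - 1\<close> contributes.\<close>
    also have "\<dots> = F $$ (i, k)"
      using ik F0 by (cases k) (auto simp: sum.delta')
    finally show "F $$ (i, k) = (M * ?S) $$ (i, k)" by simp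
  qed (use F M S in auto)
  have "F * ?D * left_pinv ?D = M * (?N * inverse_mat ?N) * ?S"
    unfolding left_pinv_def FM using M S D N inv(1)
    by (smt (verit) assoc_mult_mat mult_carrier_mat)
  also have "\<dots> = F"
    using M by (simp add: inv(2) FM)
  finally show ?thesis .
qed

section \<open>The recurrences as matrix identities\<close>

lemma G_mat_carrier [simp]: "G_mat l g m \<in> carrier_mat m m"
  by (simp add: G_mat_def)

lemma Theta_v_carrier [simp]: "Theta_v n g \<xi>v m \<in> carrier_mat n m"
  by (simp add: Theta_v_def)

lemma Theta_z_carrier [simp]: "Theta_z n l \<delta> \<xi>z m \<in> carrier_mat n m"
  by (simp add: Theta_z_def)

lemma H_mat_carrier [simp]: "H_mat \<gamma> \<delta> j \<in> carrier_mat (Suc j) j"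
  by (simp add: H_mat_def)

lemma B_mat_carrier [simp]: "B_mat l \<sigma> \<gamma> \<delta> j \<in> carrier_mat (Suc j) j"
  by (simp add: B_mat_def)

lemma Delta_mat_carrier [simp]: "Delta_mat \<delta> j \<in> carrier_mat (Suc j) j"
  by (simp add: Delta_mat_def)

text \<open>Multiplying the recurrence for \<open>v p\<close> by \<open>g p p\<close> and solving
  for \<open>z p\<close> turns the left side into the diagonal term of column \<open>p\<close> of
  the product with \<open>G_mat\<close>; the error \<open>g p p\<close> times
  \<open>\<xi>v p\<close> moves across with a minus sign, as in \<open>Theta_v\<close>. Column 0 is
  the initial data. The size \<open>m\<close> is left free because both \<open>j\<close> and
  \<open>j + 1\<close> are used later.\<close>

lemma aux_basis_eq:
  fixes g :: "nat \<Rightarrow> nat \<Rightarrow> 'a::field"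
  assumes l: "l \<ge> 1" and m: "m \<le> j + 1"
    and v: "\<And>k. k \<le> j \<Longrightarrow> v k \<in> carrier_vec n"
    and z: "\<And>k. k \<le> j \<Longrightarrow> z k \<in> carrier_vec n"
    and \<xi>v: "\<And>k. k \<le> j \<Longrightarrow> \<xi>v k \<in> carrier_vec n"
    and g: "\<And>k. k \<le> j \<Longrightarrow> g k k \<noteq> 0"
    and init: "z 0 = v 0" "g 0 0 = 1" "\<xi>v 0 = 0\<^sub>v n"
    and rec: "\<And>k. k < j \<Longrightarrow> v (k + 1) = (1 / g (k + 1) (k + 1)) \<cdot>\<^sub>v
      (z (k + 1) - finsum_vec TYPE('a) n (\<lambda>m. g m (k + 1) \<cdot>\<^sub>v v m) {k + 1 - 2 * l..k})
      + \<xi>v (k + 1)"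
  shows "col_mat n m z = col_mat n m v * G_mat l g m + Theta_v n g \<xi>v m"
proof (rule eq_matI)
  fix i p
  assume "i < dim_row (col_mat n m v * G_mat l g m + Theta_v n g \<xi>v m)"
    "p < dim_col (col_mat n m v * G_mat l g m + Theta_v n g \<xi>v m)"
  then have i: "i < n" and p: "p < m" by (simp_all add: Theta_v_def)
  have "(col_mat n m v * G_mat l g m) $$ (i, p)
      = (\<Sum>q<m. v q $ i * (if p \<le> q + 2 * l \<and> q \<le> p then g q p else 0))"
    by (subst mult_mat_index[where m = n and p = m and r = m])
      (use i p in \<open>auto simp: G_mat_def intro!: sum.cong\<close>)
  \<comment> \<open>For natural \<open>q\<close>, the truncated bound
    \<open>p - 2 * l \<le> q\<close> is equivalent to \<open>p \<le> q + 2 * l\<close>, so cutting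
    the range at 0 implements the convention that terms with negative index vanish.\<close>
  also have "\<dots> = (\<Sum>q\<in>{p - 2 * l..p}. g q p * v q $ i)"
    using p by (intro sum.mono_neutral_cong_right) auto
  also have "\<dots> = z p $ i + g p p * \<xi>v p $ i"
  proof (cases p)
    case 0
    then show ?thesis using init i by simp
  next
    case (Suc k)
    then have k: "k < j" "k + 1 \<le> j" using p m by simp_all
    let ?s = "finsum_vec TYPE('a) n (\<lambda>m. g m (k + 1) \<cdot>\<^sub>v v m) {k + 1 - 2 * l..k}"
    have s: "?s \<in> carrier_vec n" using v k by (intro finsum_vec_closed) auto
    have s_index: "?s $ i = (\<Sum>q\<in>{k + 1 - 2 * l..k}. g q (k + 1) * v q $ i)"
    proof -
      have "?s $ i = (\<Sum>q\<in>{k + 1 - 2 * l..k}. (g q (k + 1) \<cdot>\<^sub>v v q) $ i)"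
        using i v k by (intro index_finsum_vec) auto
      also have "\<dots> = (\<Sum>q\<in>{k + 1 - 2 * l..k}. g q (k + 1) * v q $ i)"
      proof (rule sum.cong[OF refl])
        fix q assume "q \<in> {k + 1 - 2 * l..k}"
        then have "v q \<in> carrier_vec n" using v k by auto
        then show "(g q (k + 1) \<cdot>\<^sub>v v q) $ i = g q (k + 1) * v q $ i" using i by auto
      qed
      finally show ?thesis .
    qed
    have "v (k + 1) $ i = (z (k + 1) $ i - ?s $ i) / g (k + 1) (k + 1) + \<xi>v (k + 1) $ i"
      using carrier_vecD[OF z[OF k(2)]] carrier_vecD[OF \<xi>v[OF k(2)]] carrier_vecD[OF s] i
      by (subst rec[OF k(1)]) simp
    then have "g (k + 1) (k + 1) * v (k + 1) $ i + ?s $ i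
        = z (k + 1) $ i + g (k + 1) (k + 1) * \<xi>v (k + 1) $ i"
      using g[OF k(2)] by (simp add: field_simps)
    \<comment> \<open>The column of \<open>G_mat\<close> runs up to the diagonal, one index further
      than the sum in the recurrence.\<close>
    moreover have "{p - 2 * l..p} = insert (k + 1) {k + 1 - 2 * l..k}"
      using Suc l by auto
    ultimately show ?thesis using s_index Suc by simp
  qed
  finally have "(col_mat n m v * G_mat l g m) $$ (i, p) = z p $ i + g p p * \<xi>v p $ i" .
  moreover have "\<xi>v p \<in> carrier_vec n" using \<xi>v p m by simp
  ultimately show "col_mat n m z $$ (i, p) =
      (col_mat n m v * G_mat l g m + Theta_v n g \<xi>v m) $$ (i, p)"
    using i p by (simp add: Theta_v_def G_mat_def del: index_mult_mat(1))
qed (simp_all add: Theta_v_def G_mat_def)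

text \<open>Column \<open>k\<close> of \<open>B_mat\<close> holds the coefficients obtained by
  solving the recurrence for \<open>A *\<^sub>v z k\<close>. In the phase \<open>l \<le> k\<close>
  this means multiplying by \<open>\<delta> (k - l)\<close>, which is why the error in
  \<open>Theta_z\<close> carries that factor.\<close>

lemma aux_basis_mult_B_mat:
  fixes A :: "'a::field mat"
  assumes l: "l \<ge> 1" and A: "A \<in> carrier_mat n n"
    and z: "\<And>k. k \<le> j \<Longrightarrow> z k \<in> carrier_vec n"
    and \<xi>z: "\<And>k. 1 \<le> k \<Longrightarrow> k \<le> j \<Longrightarrow> \<xi>z k \<in> carrier_vec n"
    and \<delta>: "\<And>k. k < j \<Longrightarrow> \<delta> k \<noteq> 0"
    and rec1: "\<And>k. k < j \<Longrightarrow> k < l \<Longrightarrow> z (k + 1) = (A - \<sigma> k \<cdot>\<^sub>m 1\<^sub>m n) *\<^sub>v z k + \<xi>z (k + 1)"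
    and rec2: "\<And>k. k < j \<Longrightarrow> l \<le> k \<Longrightarrow> z (k + 1) = (1 / \<delta> (k - l)) \<cdot>\<^sub>v
      (A *\<^sub>v z k - \<gamma> (k - l) \<cdot>\<^sub>v z k - previous 0 \<delta> (k - l) \<cdot>\<^sub>v z (k - 1)) + \<xi>z (k + 1)"
  shows "col_mat n (j + 1) z * B_mat l \<sigma> \<gamma> \<delta> j = A * col_mat n j z - Theta_z n l \<delta> \<xi>z j"
proof -
  have Az: "A * col_mat n j z = col_mat n j (\<lambda>k. A *\<^sub>v z k)"
    using A z by (intro mult_col_mat) auto
  show ?thesis unfolding Az
  proof (rule eq_matI)
    fix i k assume "i < dim_row (col_mat n j (\<lambda>k. A *\<^sub>v z k) - Theta_z n l \<delta> \<xi>z j)"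
      "k < dim_col (col_mat n j (\<lambda>k. A *\<^sub>v z k) - Theta_z n l \<delta> \<xi>z j)"
    then have i: "i < n" and k: "k < j" by (simp_all add: Theta_z_def)
    have zk: "z k \<in> carrier_vec n" "z (k - 1) \<in> carrier_vec n" "\<xi>z (k + 1) \<in> carrier_vec n"
      using z \<xi>z k by auto
    have dims: "dim_vec (z k) = n" "dim_vec (z (k - 1)) = n" "dim_vec (\<xi>z (k + 1)) = n"
      "dim_row A = n"
      using zk A by auto
    show "(col_mat n (j + 1) z * B_mat l \<sigma> \<gamma> \<delta> j) $$ (i, k) =
        (col_mat n j (\<lambda>k. A *\<^sub>v z k) - Theta_z n l \<delta> \<xi>z j) $$ (i, k)"
    proof (cases "k < l")
      case True
      have "(A - \<sigma> k \<cdot>\<^sub>m 1\<^sub>m n) *\<^sub>v z k = A *\<^sub>v z k - \<sigma> k \<cdot>\<^sub>v z k"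
        using minus_mult_distrib_mat_vec[OF A _ zk(1), of "\<sigma> k \<cdot>\<^sub>m 1\<^sub>m n"] zk
        by (simp add: smult_one_mult_vec)
      then have "z (k + 1) = A *\<^sub>v z k - \<sigma> k \<cdot>\<^sub>v z k + \<xi>z (k + 1)"
        using rec1[OF k True] by simp
      then have "z (k + 1) $ i = (A *\<^sub>v z k) $ i - \<sigma> k * z k $ i + \<xi>z (k + 1) $ i"
        using dims i by (simp del: index_mult_mat_vec)
      then show ?thesis
        unfolding B_mat_tridiag col_mat_mult_tridiag_mat[OF i k]
        using True i k dims by (simp add: Theta_z_def del: index_mult_mat_vec)
    next
      case False
      \<comment> \<open>Here \<open>1 \<le> l \<le> k\<close>, so \<open>k - 1\<close> is a genuine
        predecessor. At \<open>k = l\<close> its coefficient \<open>previous 0 \<delta> 0\<close> is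
        zero.\<close>
      have "previous (0\<^sub>v n) z k = z (k - 1)"
        using False l by (cases k) (auto simp: previous_def)
      moreover have "z (k + 1) $ i = ((A *\<^sub>v z k) $ i - \<gamma> (k - l) * z k $ i
          - previous 0 \<delta> (k - l) * z (k - 1) $ i) / \<delta> (k - l) + \<xi>z (k + 1) $ i"
        by (subst rec2) (use k False dims i in \<open>simp_all del: index_mult_mat_vec\<close>)
      moreover have "\<delta> (k - l) \<noteq> 0" using \<delta> k by simp
      ultimately show ?thesis
        unfolding B_mat_tridiag col_mat_mult_tridiag_mat[OF i k]
        using False i k dims
        by (simp add: Theta_z_def field_simps del: index_mult_mat_vec)
    qed
  qed (simp_all add: Theta_z_def B_mat_def)
qed

text \<open>\<open>Delta_mat\<close> picks columns \<open>1\<close> to \<open>j\<close> of the gap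
  and scales column \<open>k + 1\<close> by \<open>\<delta> k\<close>. For the true basis this
  clears the division in its definition; for the computed basis it gives the subdiagonal term of the
  product with \<open>H_mat\<close>, whose other two terms come from the true basis.\<close>

lemma gap_mult_Delta_mat:
  fixes A :: "'a::field mat"
  assumes A: "A \<in> carrier_mat n n"
    and v: "\<And>k. k \<le> j \<Longrightarrow> v k \<in> carrier_vec n"
    and \<delta>: "\<And>k. k < j \<Longrightarrow> \<delta> k \<noteq> 0"
  shows "(col_mat n (j + 1) (true_basis n A v \<gamma> \<delta>) - col_mat n (j + 1) v) * Delta_mat \<delta> j =
    A * col_mat n j v - col_mat n (j + 1) v * H_mat \<gamma> \<delta> j"
proof -
  let ?w = "true_basis n A v \<gamma> \<delta>"
  let ?W = "col_mat n (j + 1) ?w" and ?V = "col_mat n (j + 1) v"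
  have Av: "A * col_mat n j v = col_mat n j (\<lambda>k. A *\<^sub>v v k)"
    using A v by (intro mult_col_mat) auto
  have "(?W - ?V) * Delta_mat \<delta> j =
      ?W * Delta_mat \<delta> j - ?V * Delta_mat \<delta> j"
    by (rule minus_mult_distrib_mat[where nr = n and n = "j + 1" and nc = j]) simp_all
  also have "\<dots> = A * col_mat n j v - ?V * H_mat \<gamma> \<delta> j"
    unfolding Av
  proof (rule eq_matI)
    fix i k assume "i < dim_row (col_mat n j (\<lambda>k. A *\<^sub>v v k) - ?V * H_mat \<gamma> \<delta> j)"
      "k < dim_col (col_mat n j (\<lambda>k. A *\<^sub>v v k) - ?V * H_mat \<gamma> \<delta> j)"
    then have i: "i < n" and k: "k < j" by (simp_all add: H_mat_def)
    have p: "previous (0\<^sub>v n) v k \<in> carrier_vec n"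
      using v k by (cases k) (auto simp: previous_def)
    have dims: "dim_vec (v k) = n" "dim_vec (previous (0\<^sub>v n) v k) = n" "dim_row A = n"
      using v[of k] k p A by auto
    have "?w (k + 1) $ i = ((A *\<^sub>v v k) $ i - \<gamma> k * v k $ i
        - previous 0 \<delta> k * previous (0\<^sub>v n) v k $ i) / \<delta> k"
      using dims i by (simp add: true_basis_def del: index_mult_mat_vec)
    moreover have "(col_mat n (j + 1) f * Delta_mat \<delta> j) $$ (i, k) = \<delta> k * f (k + 1) $ i" for f
      unfolding Delta_mat_tridiag by (simp only: col_mat_mult_tridiag_mat[OF i k]) simp
    moreover have "(?V * H_mat \<gamma> \<delta> j) $$ (i, k) =
        previous 0 \<delta> k * previous (0\<^sub>v n) v k $ i + \<gamma> k * v k $ i + \<delta> k * v (k + 1) $ i"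
      unfolding H_mat_tridiag by (rule col_mat_mult_tridiag_mat[OF i k])
    moreover have "(P - Q) $$ (i, k) = P $$ (i, k) - Q $$ (i, k)" if "Q \<in> carrier_mat n j" for P Q :: "'a mat"
      using i k that by auto
    moreover have "?V * Delta_mat \<delta> j \<in> carrier_mat n j" "?V * H_mat \<gamma> \<delta> j \<in> carrier_mat n j"
      by (rule mult_carrier_mat[where n = "j + 1"]; simp)+
    ultimately show "(?W * Delta_mat \<delta> j - ?V * Delta_mat \<delta> j) $$ (i, k) =
        (col_mat n j (\<lambda>k. A *\<^sub>v v k) - ?V * H_mat \<gamma> \<delta> j) $$ (i, k)"
      using i k \<delta>[OF k] by (simp del: index_mult_mat_vec index_mult_mat(1) index_minus_mat(1))
  qed (simp_all add: H_mat_def Delta_mat_def)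
  finally show ?thesis .
qed

section \<open>Elimination of the computed vectors and cancellation of the right factors\<close>

theorem mainTheorem1:
  fixes n l j :: nat
    and A :: "'a::conjugatable_field mat"
    and v z \<xi>v \<xi>z :: "nat \<Rightarrow> 'a vec"
    and \<gamma> \<delta> \<sigma> :: "nat \<Rightarrow> 'a"
    and g :: "nat \<Rightarrow> nat \<Rightarrow> 'a"
  assumes "l \<ge> 1" and "j \<ge> 1"
    and "A \<in> carrier_mat n n"
    and "\<And>k. k \<le> j \<Longrightarrow> v k \<in> carrier_vec n"
    and "\<And>k. k \<le> j \<Longrightarrow> z k \<in> carrier_vec n"
    and "\<And>k. k \<le> j \<Longrightarrow> \<xi>v k \<in> carrier_vec n"
    and "\<And>k. 1 \<le> k \<Longrightarrow> k \<le> j \<Longrightarrow> \<xi>z k \<in> carrier_vec n"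
    and "\<And>k. k < j \<Longrightarrow> \<delta> k \<noteq> 0"
    and "\<And>k. k \<le> j \<Longrightarrow> g k k \<noteq> 0"
    and "z 0 = v 0" and "g 0 0 = 1" and "\<xi>v 0 = 0\<^sub>v n"
    and "\<And>k. k < j \<Longrightarrow>
           v (k + 1) = (1 / g (k + 1) (k + 1)) \<cdot>\<^sub>v
             (z (k + 1) - finsum_vec TYPE('a) n (\<lambda>m. g m (k + 1) \<cdot>\<^sub>v v m) {k + 1 - 2 * l..k})
             + \<xi>v (k + 1)"
    and "\<And>k. k < j \<Longrightarrow> k < l \<Longrightarrow>
           z (k + 1) = (A - \<sigma> k \<cdot>\<^sub>m 1\<^sub>m n) *\<^sub>v z k + \<xi>z (k + 1)"
    and "\<And>k. k < j \<Longrightarrow> l \<le> k \<Longrightarrow>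
           z (k + 1) = (1 / \<delta> (k - l)) \<cdot>\<^sub>v
             (A *\<^sub>v z k - \<gamma> (k - l) \<cdot>\<^sub>v z k - previous 0 \<delta> (k - l) \<cdot>\<^sub>v z (k - 1))
             + \<xi>z (k + 1)"
    and "G_mat l g (j + 1) * B_mat l \<sigma> \<gamma> \<delta> j = H_mat \<gamma> \<delta> j * G_mat l g j"
  shows "col_mat n (j + 1) (true_basis n A v \<gamma> \<delta>) - col_mat n (j + 1) v =
    (Theta_z n l \<delta> \<xi>z j - A * Theta_v n g \<xi>v j + Theta_v n g \<xi>v (j + 1) * B_mat l \<sigma> \<gamma> \<delta> j)
      * inverse_mat (G_mat l g j) * left_pinv (Delta_mat \<delta> j)"
proof -
  let ?F = "col_mat n (j + 1) (true_basis n A v \<gamma> \<delta>) - col_mat n (j + 1) v"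
  let ?V = "col_mat n j v" and ?V' = "col_mat n (j + 1) v"
  let ?Z = "col_mat n j z" and ?Z' = "col_mat n (j + 1) z"
  let ?G = "G_mat l g j" and ?G' = "G_mat l g (j + 1)"
  let ?B = "B_mat l \<sigma> \<gamma> \<delta> j" and ?H = "H_mat \<gamma> \<delta> j" and ?D = "Delta_mat \<delta> j"
  let ?T = "Theta_v n g \<xi>v j" and ?T' = "Theta_v n g \<xi>v (j + 1)" and ?R = "Theta_z n l \<delta> \<xi>z j"
  let ?X = "?R - A * ?T + ?T' * ?B"
  note A = assms(3)
  have aux: "m \<le> j + 1 \<Longrightarrow> col_mat n m z = col_mat n m v * G_mat l g m + Theta_v n g \<xi>v m" for m
    using aux_basis_eq[OF assms(1) _ assms(4-6) assms(9-13)] by blast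
  have Z: "?Z = ?V * ?G + ?T" and Z': "?Z' = ?V' * ?G' + ?T'"
    by (simp_all add: aux)
  have ZB: "?Z' * ?B = A * ?Z - ?R"
    by (rule aux_basis_mult_B_mat[OF assms(1,3,5,7,8,14,15)])
  have FD: "?F * ?D = A * ?V - ?V' * ?H"
    by (rule gap_mult_Delta_mat[OF assms(3,4,8)])
  have AZ: "A * ?Z = A * (?V * ?G) + A * ?T"
    unfolding Z by (rule mult_add_distrib_mat[OF A mult_carrier_mat[where n = j], where nc = j]) simp_all
  \<comment> \<open>The assumed identity \<open>?G' * ?B = ?H * ?G\<close> produces
    \<open>?V' * (?H * ?G)\<close>, the same term that arises when \<open>FD\<close> is multiplied
    by \<open>?G\<close>.\<close>
  have ZB': "?Z' * ?B = ?V' * (?H * ?G) + ?T' * ?B"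
  proof -
    have "?Z' * ?B = ?V' * ?G' * ?B + ?T' * ?B"
      unfolding Z'
      by (rule add_mult_distrib_mat[where nr = n and n = "j + 1" and nc = j])
        (rule mult_carrier_mat[where n = "j + 1"] | simp)+
    also have "?V' * ?G' * ?B = ?V' * (?G' * ?B)"
      by (rule assoc_mult_mat[where n\<^sub>1 = n and n\<^sub>2 = "j + 1" and n\<^sub>3 = "j + 1" and n\<^sub>4 = j]) simp_all
    finally show ?thesis by (simp only: assms(16))
  qed
  have FDG: "?F * ?D * ?G = ?X"
  proof -
    have "?F * ?D * ?G = A * ?V * ?G - ?V' * ?H * ?G"
      unfolding FD
      by (rule minus_mult_distrib_mat[OF mult_carrier_mat[OF A, where nc = j]
        mult_carrier_mat[where n = "j + 1"], where nc = j]) simp_all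
    also have "\<dots> = A * (?V * ?G) - ?V' * (?H * ?G)"
      using A by (simp add: assoc_mult_mat[where n\<^sub>1 = n and n\<^sub>2 = n and n\<^sub>3 = j and n\<^sub>4 = j]
        assoc_mult_mat[where n\<^sub>1 = n and n\<^sub>2 = "j + 1" and n\<^sub>3 = j and n\<^sub>4 = j])
    also have "\<dots> = ?X"
    proof -
      \<comment> \<open>Two evaluations of \<open>?Z' * ?B\<close> are equated: one expands
        \<open>?Z'\<close> through \<open>?V'\<close>, the other uses the recurrence for
        \<open>z\<close> and expands \<open>?Z\<close> through \<open>?V\<close>.\<close>
      have eq: "?V' * (?H * ?G) + ?T' * ?B = A * (?V * ?G) + A * ?T - ?R"
        using ZB ZB' AZ by simp
      \<comment> \<open>Rearranging \<open>eq\<close> is additive algebra, done entrywise because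
        matrix addition and subtraction obey the group laws only for matching dimensions.\<close>
      have *: "P - Q = S - U + W"
        if "P \<in> carrier_mat n j" "Q \<in> carrier_mat n j" "S \<in> carrier_mat n j"
          "U \<in> carrier_mat n j" "W \<in> carrier_mat n j" "Q + W = P + U - S"
        for P Q S U W :: "'a mat"
      proof (rule eq_matI)
        fix i k assume ik: "i < dim_row (S - U + W)" "k < dim_col (S - U + W)"
        have "(Q + W) $$ (i, k) = (P + U - S) $$ (i, k)" using that(6) by simp
        then show "(P - Q) $$ (i, k) = (S - U + W) $$ (i, k)"
          using that(1-5) ik by (auto simp: algebra_simps)
      qed (use that(1-5) in auto)
      show ?thesis
        using A by (intro * eq; intro carrier_matI)
          (simp_all add: Theta_v_def Theta_z_def G_mat_def B_mat_def)
    qed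
    finally show ?thesis .
  qed
  have "upper_triangular ?G" "\<And>i. i < j \<Longrightarrow> ?G $$ (i, i) \<noteq> 0"
    using assms(9) by (auto simp: G_mat_def intro!: upper_triangularI)
  note inv = inverse_mat_upper_triangular[OF G_mat_carrier this]
  have FDc: "?F * ?D \<in> carrier_mat n j"
    by (rule mult_carrier_mat[where n = "j + 1"]) (auto intro: minus_carrier_mat)
  have "?X * inverse_mat ?G = ?F * ?D * ?G * inverse_mat ?G"
    by (simp only: FDG)
  also have "\<dots> = ?F * ?D * (?G * inverse_mat ?G)"
    by (rule assoc_mult_mat[OF FDc G_mat_carrier inv(1)])
  also have "\<dots> = ?F * ?D"
    using FDc by (simp only: inv(2) right_mult_one_mat)
  finally have "?X * inverse_mat ?G = ?F * ?D" .
  \<comment> \<open>Column 0 of the gap vanishes because \<open>true_basis\<close> starts from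
    \<open>v 0\<close> itself.\<close>
  moreover have "?F * ?D * left_pinv ?D = ?F"
    by (rule mult_Delta_mat_left_pinv)
      (auto simp: true_basis_def assms(8) intro: minus_carrier_mat)
  ultimately show ?thesis by simp
qed

end
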